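(* Let $V$ satisfy $(V)$ and $\eta$ satisfy $(\eta)$ (as stated in the context), and let $\rho_o\in(L^1\cap L^\infty\cap BV)(\mathbb R^n;\mathbb R^m)$. Assume moreover: (1) for all $w\in\mathbb R^{n\times m}$, $V(w)=v(\|w\|)\,w$ with $v$ such that $v(s)>0$ for all $s>0$; (2) for all $x\in\mathbb R^n$, $\eta(x)=\tilde\eta(\|x\|)$ with $\tilde\eta'\le0$ on $\mathbb R_+$ and $\operatorname{spt}\tilde\eta=[-\ell,\ell]$; (3) for all $i\in\{1,\dots,m\}$, $\rho_{o,i}(x)\ge0$ for a.e. $x\in\mathbb R^n$. Let $\mathcal G_t\rho_o$ be the solution to $\partial_t \rho_i + \nabla\cdot(\rho_i V_i(\nabla\rho*\eta))=0$, $i\in\{1,\dots,m\}$, with initial datum $\rho_o$ at time $0$. Then: (i) If $C\subseteq\mathbb R^n$ is closed and convex and $i\in\{1,\dots,m\}$, then $\operatorname{spt}\rho_{o,i}\subseteq C$ implies $\operatorname{spt}(\mathcal G_t\rho_o)_i\subseteq C$ for all $t\in\mathbb R_+$. (ii) If $\operatorname{spt}\rho_o$ is bounded, then for all $t\in\mathbb R_+$ and $i\in\{1,\dots,m\}$, $\operatorname{spt}(\mathcal G_t\rho_o)_i\subseteq\overline{\mathrm{co}}\,\operatorname{spt}\rho_{o,i}$.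
   Context: $n,m\ge1$ are integers and $\mathbb R_+=[0,+\infty[$. All spaces $\mathbb R^n$, $\mathbb R^{n\times m}$ carry the Euclidean norm. $\|u\|_{W^{1,\infty}}=\|u\|_{L^\infty}+\|Du\|_{L^\infty}$. $BV$ is the set of $L^1_{loc}$ functions whose distributional derivative is a Radon measure with finite total variation. $\nabla$ is the differential operator in the space variable $x$; $DV$ is the total derivative of $V$. The support $\operatorname{spt}\rho$ of an $L^1$ function is the complement of the union of all open sets on which $\rho=0$ a.e.; $\overline{\mathrm{co}}\,S$ is the closed convex hull of $S$. The function $\tilde\eta$ is regarded as an even function on $\mathbb R$ (whence its support is $[-\ell,\ell]$, $\ell>0$ being the radius of the support of $\eta$). Assumption $(\eta)$: $\eta\in (C^3\cap W^{3,1}\cap W^{3,\infty})(\mathbb R^n;\mathbb R)$. Assumption $(V)$: $V\in C^2(\mathbb R^{n\times m};\mathbb R^{n\times m})$, $V(0)=0$ and $\|DV\|_{W^{1,\infty}(\mathbb R^{n\times m};\mathbb R^{(n\times m)^2})}\le L_V$ for an $L_V\in\mathbb R_+$. Write $V=[V_1\cdots V_m]$ with columns $V_i\in\mathbb R^n$. For $\rho=(\rho_1,\dots,\rho_m)$, $\nabla\rho*\eta$ is the $n\times m$ matrix with entries $(\nabla\rho*\eta)_{ji}=\partial_{x_j}(\rho_i*\eta)$, where $(\rho_i(t)*\eta)(x)=\int_{\mathbb R^n}\rho_i(t,\xi)\,\eta(x-\xi)\,d\xi$. Solution: for a non trivial real interval $I$, $\rho\in C^0(I;L^1(\mathbb R^n;\mathbb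 R^m))$ is a solution to the system on $I$ if, setting $v_i(t,x)=V_i\big((\nabla\rho*\eta)(t,x)\big)$, each $\rho_i$ is a solution on $I$ of the linear equation $\partial_t\rho_i+\nabla\cdot(\rho_i\,v_i(t,x))=0$, meaning the Lagrangian one: with datum $\rho_{o,i}$ at time $0\in I$, $$\rho_i(t,x)=\rho_{o,i}\big(X_i(0;t,x)\big)\exp\Big(-\int_0^t(\nabla\cdot v_i)\big(\tau,X_i(\tau;t,x)\big)\,d\tau\Big),$$ where $t\mapsto X_i(t;t_o,x_o)$ solves $\dot x=v_i(t,x)$, $x(t_o)=x_o$ (it coincides with the distributional and with the Kružkov entropy solution). Under $(\eta)$ and $(V)$, for every $\rho_o\in(L^1\cap L^\infty\cap BV)(\mathbb R^n;\mathbb R^m)$ there is a unique global solution on $\mathbb R$ with datum $\rho_o$ at time $0$; it is denoted $t\mapsto\mathcal G_t\rho_o$. *)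

theory Defs
  imports "HOL-Analysis.Analysis" "HOL-Probability.Essential_Supremum"
begin

fun Ck :: "nat \<Rightarrow> ('a::real_normed_vector \<Rightarrow> 'b::real_normed_vector) \<Rightarrow> bool" where
  "Ck 0 f \<longleftrightarrow> continuous_on UNIV f"
| "Ck (Suc k) f \<longleftrightarrow> (\<forall>x. f differentiable (at x)) \<and>
     (\<forall>h. Ck k (\<lambda>x. frechet_derivative f (at x) h))"

definition test_function :: "('a::real_normed_vector \<Rightarrow> real) \<Rightarrow> bool" where
  "test_function \<phi> \<longleftrightarrow> (\<forall>k. Ck k \<phi>) \<and> compact (closure {x. \<phi> x \<noteq> 0})"

definition L1 :: "('a::euclidean_space \<Rightarrow> 'b::euclidean_space) set" where
  "L1 = {f. integrable lebesgue f}"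

definition Linf :: "('a::euclidean_space \<Rightarrow> 'b::euclidean_space) set" where
  "Linf = {f. f \<in> borel_measurable lebesgue \<and> (\<exists>M. AE x in lebesgue. norm (f x) \<le> M)}"

definition L1loc :: "('a::euclidean_space \<Rightarrow> 'b::euclidean_space) set" where
  "L1loc = {f. \<forall>K. compact K \<longrightarrow> set_integrable lebesgue K f}"

definition weak_derivative ::
    "'a::euclidean_space \<Rightarrow> ('a \<Rightarrow> real) \<Rightarrow> ('a \<Rightarrow> real) \<Rightarrow> bool" where
  "weak_derivative b f g \<longleftrightarrow> f \<in> L1loc \<and> g \<in> L1loc \<and>
     (\<forall>\<phi>. test_function \<phi> \<longrightarrow>
        (LINT x|lebesgue. f x * frechet_derivative \<phi> (at x) b)
          = - (LINT x|lebesgue. g x * \<phi> x))"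

text \<open>\<open>sobolev k L\<close> is \<open>W\<^sup>k\<^sup>,\<^sup>p\<close> for \<open>L = L\<^sup>p\<close>: all iterated weak partial derivatives of order at
  most \<open>k\<close> exist and lie in \<open>L\<close>.\<close>

fun sobolev :: "nat \<Rightarrow> ('a::euclidean_space \<Rightarrow> real) set \<Rightarrow> ('a \<Rightarrow> real) set" where
  "sobolev 0 L = L"
| "sobolev (Suc k) L = {f \<in> L. \<forall>b\<in>Basis. \<exists>g \<in> sobolev k L. weak_derivative b f g}"

text \<open>The distributional derivative of each component in each coordinate direction is a signed
  Radon measure of finite total variation, represented as a difference \<open>\<mu> - \<nu>\<close> of two finite
  positive Borel measures (on a Euclidean space these are automatically Radon).\<close>

definition BV :: "('a::euclidean_space \<Rightarrow> 'b::euclidean_space) set" where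
  "BV = {f. f \<in> L1loc \<and>
     (\<forall>c\<in>Basis. \<forall>b\<in>Basis. \<exists>\<mu> \<nu>. finite_measure \<mu> \<and> finite_measure \<nu> \<and>
        sets \<mu> = sets borel \<and> sets \<nu> = sets borel \<and>
        (\<forall>\<phi>. test_function \<phi> \<longrightarrow>
           (LINT x|lebesgue. (f x \<bullet> c) * frechet_derivative \<phi> (at x) b)
             = - ((LINT x|\<mu>. \<phi> x) - (LINT x|\<nu>. \<phi> x))))}"

definition spt :: "('a::euclidean_space \<Rightarrow> 'b::real_normed_vector) \<Rightarrow> 'a set" where
  "spt f = - \<Union>{U. open U \<and> (AE x in lebesgue. x \<in> U \<longrightarrow> f x = 0)}"

definition assumption_eta :: "(real^'n \<Rightarrow> real) \<Rightarrow> bool" where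
  "assumption_eta \<eta> \<longleftrightarrow> Ck 3 \<eta> \<and> \<eta> \<in> sobolev 3 L1 \<and> \<eta> \<in> sobolev 3 Linf"

text \<open>An \<open>n \<times> m\<close> matrix has type \<open>real^'m^'n\<close>, whose norm is the Euclidean one of its entries.
  \<open>total_deriv u w\<close> collects all partial derivatives of \<open>u\<close> at \<open>w\<close>; its (nested) vector norm is
  again the Euclidean norm of all entries.\<close>

definition total_deriv ::
    "(real^'m^'n \<Rightarrow> 'b::real_normed_vector) \<Rightarrow> real^'m^'n \<Rightarrow> 'b^'m^'n" where
  "total_deriv u w = (\<chi> j i. frechet_derivative u (at w) (axis j (axis i 1)))"

definition Linf_norm :: "('a::euclidean_space \<Rightarrow> 'b::real_normed_vector) \<Rightarrow> ereal" where
  "Linf_norm u = esssup lebesgue (\<lambda>x. ereal (norm (u x)))"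

text \<open>Only applied to the \<open>C\<^sup>1\<close> function \<open>DV\<close>, so the classical derivative is meant.\<close>

definition W1inf_norm :: "(real^'m^'n \<Rightarrow> 'b::real_normed_vector) \<Rightarrow> ereal" where
  "W1inf_norm u = Linf_norm u + Linf_norm (total_deriv u)"

definition assumption_V :: "(real^'m^'n \<Rightarrow> real^'m^'n) \<Rightarrow> bool" where
  "assumption_V V \<longleftrightarrow> Ck 2 V \<and> V 0 = 0 \<and>
     (\<exists>L_V::real. L_V \<ge> 0 \<and> W1inf_norm (total_deriv V) \<le> ereal L_V)"

definition convolution :: "('a::euclidean_space \<Rightarrow> real) \<Rightarrow> ('a \<Rightarrow> real) \<Rightarrow> 'a \<Rightarrow> real" where
  "convolution f g x = (LINT \<xi>|lebesgue. f \<xi> * g (x - \<xi>))"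

definition grad_conv ::
    "(real^'n \<Rightarrow> real^'m) \<Rightarrow> (real^'n \<Rightarrow> real) \<Rightarrow> real^'n \<Rightarrow> real^'m^'n" where
  "grad_conv r \<eta> x =
     (\<chi> j i. frechet_derivative (convolution (\<lambda>\<xi>. r \<xi> $ i) \<eta>) (at x) (axis j 1))"

definition divergence :: "(real^'n \<Rightarrow> real^'n) \<Rightarrow> real^'n \<Rightarrow> real" where
  "divergence u x = trace (jacobian u (at x))"

text \<open>\<open>X t t\<^sub>o x\<^sub>o\<close> is the position at time \<open>t\<close> of the characteristic through \<open>x\<^sub>o\<close> at time \<open>t\<^sub>o\<close>.\<close>

definition is_flow ::
    "real set \<Rightarrow> (real \<Rightarrow> real^'n \<Rightarrow> real^'n) \<Rightarrow> (real \<Rightarrow> real \<Rightarrow> real^'n \<Rightarrow> real^'n) \<Rightarrow> bool" where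
  "is_flow I u X \<longleftrightarrow> (\<forall>t\<^sub>o\<in>I. \<forall>x\<^sub>o. X t\<^sub>o t\<^sub>o x\<^sub>o = x\<^sub>o \<and>
     (\<forall>t\<in>I. ((\<lambda>s. X s t\<^sub>o x\<^sub>o) has_vector_derivative u t (X t t\<^sub>o x\<^sub>o)) (at t within I)))"

text \<open>Lagrangian solution of \<open>\<partial>\<^sub>t r + \<nabla> \<cdot> (r u) = 0\<close> with datum \<open>r\<^sub>o\<close> at time \<open>0\<close>; the time integral
  is oriented, so negative times are covered.\<close>

definition lagrangian_solution ::
    "real set \<Rightarrow> (real \<Rightarrow> real^'n \<Rightarrow> real^'n) \<Rightarrow> (real^'n \<Rightarrow> real) \<Rightarrow> (real \<Rightarrow> real^'n \<Rightarrow> real) \<Rightarrow> bool"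
  where
  "lagrangian_solution I u r\<^sub>o r \<longleftrightarrow> (\<exists>X. is_flow I u X \<and>
     (\<forall>t\<in>I. AE x in lebesgue.
        r t x = r\<^sub>o (X 0 t x) * exp (- (LBINT \<tau>=0..t. divergence (u \<tau>) (X \<tau> t x)))))"

definition C0_L1 ::
    "real set \<Rightarrow> (real \<Rightarrow> 'a::euclidean_space \<Rightarrow> 'b::euclidean_space) \<Rightarrow> bool" where
  "C0_L1 I \<rho> \<longleftrightarrow> (\<forall>t\<in>I. \<rho> t \<in> L1) \<and>
     (\<forall>t\<in>I. ((\<lambda>s. LINT x|lebesgue. norm (\<rho> s x - \<rho> t x)) \<longlongrightarrow> 0) (at t within I))"

definition is_solution ::
    "real set \<Rightarrow> (real^'m^'n \<Rightarrow> real^'m^'n) \<Rightarrow> (real^'n \<Rightarrow> real) \<Rightarrow>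
     (real^'n \<Rightarrow> real^'m) \<Rightarrow> (real \<Rightarrow> real^'n \<Rightarrow> real^'m) \<Rightarrow> bool" where
  "is_solution I V \<eta> \<rho>\<^sub>o \<rho> \<longleftrightarrow>
     is_interval I \<and> interior I \<noteq> {} \<and> 0 \<in> I \<and> C0_L1 I \<rho> \<and>
     (\<forall>i. lagrangian_solution I (\<lambda>t x. column i (V (grad_conv (\<rho> t) \<eta> x)))
        (\<lambda>x. \<rho>\<^sub>o x $ i) (\<lambda>t x. \<rho> t x $ i))"

end

theory Submission
  imports Defs
begin

text \<open>
Both claims say that mass never leaves a closed convex set containing it; the second is the first for the closed
convex hull of the initial support. A closed convex set is an intersection of closed half-spaces, so it suffices
to confine one component \<open>\<rho>\<^sub>i\<close> to a half-space \<open>a \<bullet> x \<le> b\<close>.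

The mechanism is attraction. The form of \<open>V\<close> makes the velocity of \<open>\<rho>\<^sub>i\<close> a
nonnegative multiple of the gradient of \<open>\<rho>\<^sub>i * \<eta>\<close>. At a point beyond all the mass
in direction \<open>a\<close>, moving along \<open>a\<close> increases the distance to every point of the mass.
Since \<open>\<eta>\<close> is radially decreasing and \<open>\<rho>\<^sub>i\<close> is nonnegative,
\<open>\<rho>\<^sub>i * \<eta>\<close> does not increase along \<open>a\<close> there
(\<open>convolution_derivative_nonpos\<close>), so the velocity points back.

This is known only beyond the mass that is present at the given time, which is the very thing to be controlled.
The circularity is broken in \<open>halfspace_invariant\<close>: the velocity is Lipschitz in space, so the
outward speed is bounded by a multiple of the gap to the farthest level \<open>N\<close> ever reached on
\<open>[0, T]\<close>. Gronwall's inequality then keeps every trajectory uniformly below \<open>N\<close> unless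
\<open>N \<le> b\<close>, and a supremum leaves no such uniform gap.

The Lipschitz bounds come from compact support: the radial profile is continuous with bounded support, so
\<open>\<eta>\<close> and its first derivatives are bounded and Lipschitz (\<open>C11_kernel_if_vanishing\<close>),
the nonlocal gradient is bounded and Lipschitz in space uniformly on compact time intervals, and
\<open>V\<close> is Lipschitz on the ball where it is evaluated. Finally, the flow maps are bi-Lipschitz, so
that sign and vanishing of the density, known almost everywhere at time zero, are transported along them
(\<open>AE_flow_transport\<close>).
\<close>

section \<open>Supports\<close>

text \<open>
The direction from left to right needs more than the definition: the complement of the support is a union of
possibly uncountably many null-open sets, and only the Lindelof property reduces it to a countable one.
\<close>

lemma spt_subset_iff:
  fixes f :: "'a::euclidean_space \<Rightarrow> 'b::real_normed_vector"
  assumes "closed C"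
  shows "spt f \<subseteq> C \<longleftrightarrow> (AE x in lebesgue. x \<notin> C \<longrightarrow> f x = 0)"
proof
  assume sub: "spt f \<subseteq> C"
  let ?F = "{U. open U \<and> (AE x in lebesgue. x \<in> U \<longrightarrow> f x = 0)}"
  obtain F' where F': "F' \<subseteq> ?F" "countable F'" "\<Union>F' = \<Union>?F"
    using Lindelof[of ?F] by blast
  have "AE x in lebesgue. \<forall>U\<in>F'. x \<in> U \<longrightarrow> f x = 0"
    using F'(1,2) by (subst AE_ball_countable) auto
  moreover have "x \<in> \<Union>F'" if "x \<notin> C" for x
    using sub that unfolding F'(3) spt_def by blast
  ultimately show "AE x in lebesgue. x \<notin> C \<longrightarrow> f x = 0"
    by (auto elim!: eventually_mono)
next
  assume "AE x in lebesgue. x \<notin> C \<longrightarrow> f x = 0"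
  then have "- C \<in> {U. open U \<and> (AE x in lebesgue. x \<in> U \<longrightarrow> f x = 0)}"
    using assms by (simp add: open_Compl)
  then show "spt f \<subseteq> C"
    unfolding spt_def by blast
qed

lemma closed_spt: "closed (spt f)"
  unfolding spt_def by (intro closed_Compl open_Union) auto

section \<open>Lipschitz bounds from continuous derivatives\<close>

lemma Ck_Suc_differentiable: "Ck (Suc k) f \<Longrightarrow> f differentiable (at x)"
  by simp

lemma Ck_continuous: "Ck k f \<Longrightarrow> continuous_on UNIV f"
  by (cases k) (auto intro!: differentiable_imp_continuous_on differentiable_at_imp_differentiable_on)

lemma Ck_Suc_derivative: "Ck (Suc k) f \<Longrightarrow> Ck k (\<lambda>x. frechet_derivative f (at x) h)"
  by simp

lemma norm_diff_le_partial_derivatives: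
  fixes f :: "'a::euclidean_space \<Rightarrow> 'b::real_normed_vector"
  assumes "convex S" and diff: "\<And>x. x \<in> S \<Longrightarrow> f differentiable (at x)"
    and B: "\<And>x. x \<in> S \<Longrightarrow> (\<Sum>b\<in>Basis. norm (frechet_derivative f (at x) b)) \<le> B"
    and "x \<in> S" "y \<in> S"
  shows "norm (f x - f y) \<le> B * norm (x - y)"
proof (rule differentiable_bound[OF \<open>convex S\<close> _ _ \<open>x \<in> S\<close> \<open>y \<in> S\<close>])
  fix x assume x: "x \<in> S"
  have "(f has_derivative frechet_derivative f (at x)) (at x)"
    using diff[OF x] by (simp add: frechet_derivative_works)
  then show "(f has_derivative frechet_derivative f (at x)) (at x within S)"
    and "onorm (frechet_derivative f (at x)) \<le> B"
    using B[OF x] by (auto intro: has_derivative_at_withinI onorm_componentwise_le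
        has_derivative_bounded_linear)
qed

lemma Ck_lipschitz_on_compact_convex:
  fixes f :: "'a::euclidean_space \<Rightarrow> 'b::real_normed_vector"
  assumes f: "Ck (Suc k) f" and K: "compact K" "convex K"
  shows "\<exists>L\<ge>0. \<forall>x\<in>K. \<forall>y\<in>K. norm (f x - f y) \<le> L * norm (x - y)"
proof -
  let ?g = "\<lambda>x. \<Sum>b\<in>Basis. norm (frechet_derivative f (at x) b)"
  have "continuous_on K ?g"
    using Ck_continuous[OF Ck_Suc_derivative[OF f]]
    by (intro continuous_intros) (blast intro: continuous_on_subset)
  then have "bounded (?g ` K)"
    using K(1) compact_continuous_image compact_imp_bounded by blast
  then obtain B where "\<forall>x\<in>K. norm (?g x) \<le> B"
    by (auto simp: bounded_iff)
  then have B: "?g x \<le> max 0 B" if "x \<in> K" for x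
    using that by fastforce
  show ?thesis
    using norm_diff_le_partial_derivatives[OF K(2) Ck_Suc_differentiable[OF f] B]
    by (intro exI[of _ "max 0 B"]) auto
qed

lemma continuous_vanishing_bounded:
  fixes f :: "'a::euclidean_space \<Rightarrow> 'b::real_normed_vector"
  assumes "continuous_on UNIV f" and zero: "\<And>x. norm x > R \<Longrightarrow> f x = 0"
  shows "\<exists>B\<ge>0. \<forall>x. norm (f x) \<le> B"
proof -
  have "bounded (f ` cball 0 R)"
    using assms(1) by (metis compact_cball compact_continuous_image compact_imp_bounded
        continuous_on_subset subset_UNIV)
  then obtain B where "\<forall>x\<in>cball 0 R. norm (f x) \<le> B"
    by (auto simp: bounded_iff)
  then have "norm (f x) \<le> max 0 B" for x
    using zero[of x] by (cases "norm x > R") (auto simp: le_max_iff_disj)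
  then show ?thesis
    by (intro exI[of _ "max 0 B"]) auto
qed

lemma frechet_derivative_vanishing:
  fixes f :: "'a::real_normed_vector \<Rightarrow> 'b::real_normed_vector"
  assumes zero: "\<And>x. norm x > R \<Longrightarrow> f x = 0" and x: "norm x > R"
  shows "frechet_derivative f (at x) h = 0"
proof -
  have "open {x::'a. norm x > R}"
    by (intro open_Collect_less continuous_intros)
  then have "(f has_derivative (\<lambda>_. 0)) (at x)"
    using x zero by (intro has_derivative_transform_within_open[OF has_derivative_const[of 0]]) auto
  then show ?thesis
    by (metis frechet_derivative_at)
qed

text \<open>
Compact support upgrades smoothness to global bounds: the derivative inherits the vanishing set and is therefore
bounded on the whole space.
\<close>

lemma Ck_vanishing_lipschitz:
  fixes f :: "'a::euclidean_space \<Rightarrow> 'b::real_normed_vector"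
  assumes f: "Ck (Suc k) f" and zero: "\<And>x. norm x > R \<Longrightarrow> f x = 0"
  shows "\<exists>L\<ge>0. \<forall>x y. norm (f x - f y) \<le> L * norm (x - y)"
proof -
  let ?g = "\<lambda>x. \<Sum>b\<in>Basis. norm (frechet_derivative f (at x) b)"
  have "continuous_on UNIV ?g"
    using Ck_continuous[OF Ck_Suc_derivative[OF f]] by (intro continuous_intros)
  moreover have "?g x = 0" if "norm x > R" for x
    using frechet_derivative_vanishing[OF zero that] by simp
  ultimately obtain L where L: "L \<ge> 0" "\<And>x. norm (?g x) \<le> L"
    using continuous_vanishing_bounded[of ?g R] by auto
  then have "?g x \<le> L" for x
    using abs_le_D1[of "?g x"] by (simp add: real_norm_def)
  then show ?thesis
    using norm_diff_le_partial_derivatives[OF convex_UNIV Ck_Suc_differentiable[OF f]] L(1)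
    by blast
qed

lemma frechet_derivative_eq_sum_Basis:
  fixes f :: "'a::euclidean_space \<Rightarrow> 'b::real_normed_vector"
  assumes "f differentiable (at x)"
  shows "frechet_derivative f (at x) h = (\<Sum>b\<in>Basis. (h \<bullet> b) *\<^sub>R frechet_derivative f (at x) b)"
proof -
  have l: "linear (frechet_derivative f (at x))"
    using assms by (rule linear_frechet_derivative)
  have "frechet_derivative f (at x) h = frechet_derivative f (at x) (\<Sum>b\<in>Basis. (h \<bullet> b) *\<^sub>R b)"
    by (simp add: euclidean_representation)
  also have "\<dots> = (\<Sum>b\<in>Basis. (h \<bullet> b) *\<^sub>R frechet_derivative f (at x) b)"
    by (simp add: linear_sum[OF l] linear_scale[OF l])
  finally show ?thesis .
qed

section \<open>Convolution with a kernel that has Lipschitz derivatives\<close>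

lemma integrable_mult_translated_kernel:
  fixes f g :: "'a::euclidean_space \<Rightarrow> real"
  assumes f: "integrable lebesgue f" and g: "continuous_on UNIV g" "\<And>x. \<bar>g x\<bar> \<le> M"
  shows "integrable lebesgue (\<lambda>\<xi>. f \<xi> * g (x - \<xi>))"
proof (rule Bochner_Integration.integrable_bound)
  show "integrable lebesgue (\<lambda>\<xi>. M * f \<xi>)"
    using f by simp
  have "continuous_on UNIV (\<lambda>\<xi>. g (x - \<xi>))"
    by (rule continuous_on_compose2[OF g(1)]) (auto intro!: continuous_intros)
  then have "(\<lambda>\<xi>. g (x - \<xi>)) \<in> borel_measurable lebesgue"
    by (intro measurable_completion) (simp add: borel_measurable_continuous_onI)
  then show "(\<lambda>\<xi>. f \<xi> * g (x - \<xi>)) \<in> borel_measurable lebesgue"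
    using f by (intro borel_measurable_times) auto
  have "\<bar>f \<xi>\<bar> * \<bar>g (x - \<xi>)\<bar> \<le> \<bar>f \<xi>\<bar> * \<bar>M\<bar>" for \<xi>
    using g(2)[of "x - \<xi>"] by (intro mult_left_mono) auto
  then show "AE \<xi> in lebesgue. norm (f \<xi> * g (x - \<xi>)) \<le> norm (M * f \<xi>)"
    by (simp add: abs_mult mult.commute)
qed

lemma abs_integral_le_mult_L1:
  fixes f w :: "'a::euclidean_space \<Rightarrow> real"
  assumes f: "integrable lebesgue f" and w: "integrable lebesgue (\<lambda>\<xi>. f \<xi> * w \<xi>)"
    and B: "\<And>\<xi>. \<bar>w \<xi>\<bar> \<le> B"
  shows "\<bar>LINT \<xi>|lebesgue. f \<xi> * w \<xi>\<bar> \<le> B * (LINT \<xi>|lebesgue. \<bar>f \<xi>\<bar>)"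
proof -
  have "\<bar>LINT \<xi>|lebesgue. f \<xi> * w \<xi>\<bar> \<le> (LINT \<xi>|lebesgue. \<bar>f \<xi> * w \<xi>\<bar>)"
    by (rule integral_abs_bound)
  also have "\<dots> \<le> (LINT \<xi>|lebesgue. B * \<bar>f \<xi>\<bar>)"
  proof (rule integral_mono)
    show "\<bar>f \<xi> * w \<xi>\<bar> \<le> B * \<bar>f \<xi>\<bar>" for \<xi>
      using mult_right_mono[OF B[of \<xi>], of "\<bar>f \<xi>\<bar>"] by (simp add: abs_mult mult.commute)
  qed (use f w in auto)
  finally show ?thesis
    by simp
qed

text \<open>
The linearization estimate on the ball of radius \<open>norm (y - x)\<close> around \<open>x\<close>; the
dimension enters because the Lipschitz bound is assumed for the partial derivatives, whereas the remainder is
controlled by the operator norm of the derivative.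
\<close>

lemma first_order_remainder_le:
  fixes g :: "'a::euclidean_space \<Rightarrow> real"
  assumes g: "\<And>x. g differentiable (at x)" and K: "K \<ge> 0"
    and lip: "\<And>b x y. b \<in> Basis \<Longrightarrow>
      \<bar>frechet_derivative g (at x) b - frechet_derivative g (at y) b\<bar> \<le> K * norm (x - y)"
  shows "\<bar>g y - g x - frechet_derivative g (at x) (y - x)\<bar>
    \<le> (real DIM('a) * K) * (norm (y - x) * norm (y - x))"
proof -
  let ?D = "\<lambda>x. frechet_derivative g (at x)"
  have der: "(g has_derivative ?D z) (at z)" for z
    using g by (simp add: frechet_derivative_works)
  have "norm (g y - g x - ?D x (y - x)) \<le> norm (y - x) * (real DIM('a) * K * norm (y - x))"
  proof (rule differentiable_bound_linearization[where S = "cball x (norm (y - x))" and f' = ?D])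
    show "x + t *\<^sub>R (y - x) \<in> cball x (norm (y - x))" if "t \<in> {0..1}" for t
      using that mult_right_mono[of t 1 "norm (y - x)"] by (simp add: dist_norm)
    show "(g has_derivative ?D z) (at z within cball x (norm (y - x)))" for z
      using der has_derivative_at_withinI by blast
    fix z assume z: "z \<in> cball x (norm (y - x))"
    have "bounded_linear (\<lambda>h. ?D z h - ?D x h)"
      using der by (intro bounded_linear_sub has_derivative_bounded_linear)
    then have "onorm (\<lambda>h. ?D z h - ?D x h) \<le> (\<Sum>b\<in>Basis. \<bar>?D z b - ?D x b\<bar>)"
      using onorm_componentwise by fastforce
    also have "\<dots> \<le> (\<Sum>b\<in>(Basis::'a set). K * norm (y - x))"
    proof (rule sum_mono)
      fix b :: 'a assume "b \<in> Basis"
      then have "\<bar>?D z b - ?D x b\<bar> \<le> K * norm (z - x)"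
        by (rule lip)
      also have "\<dots> \<le> K * norm (y - x)"
        using z K by (intro mult_left_mono) (auto simp: dist_norm norm_minus_commute)
      finally show "\<bar>?D z b - ?D x b\<bar> \<le> K * norm (y - x)" .
    qed
    finally show "onorm (?D z - ?D x) \<le> real DIM('a) * K * norm (y - x)"
      by (simp add: fun_diff_def mult.assoc)
  qed simp
  then show ?thesis
    by (simp add: mult.assoc mult.left_commute)
qed

text \<open>
The constants are kept explicit because they determine, together with the \<open>L\<^sup>1\<close> norm of
the density, a Lipschitz constant of the velocity that is uniform on compact time intervals.
\<close>

locale C11_kernel =
  fixes g :: "'a::euclidean_space \<Rightarrow> real" and M K :: real
  assumes differentiable: "\<And>x. g differentiable (at x)"
    and bounded: "\<And>x. \<bar>g x\<bar> \<le> M"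
    and derivative_continuous: "\<And>h. continuous_on UNIV (\<lambda>x. frechet_derivative g (at x) h)"
    and partial_le: "\<And>b x. b \<in> Basis \<Longrightarrow> \<bar>frechet_derivative g (at x) b\<bar> \<le> M"
    and K_nonneg: "K \<ge> 0"
    and partial_lipschitz: "\<And>b x y. b \<in> Basis \<Longrightarrow>
      \<bar>frechet_derivative g (at x) b - frechet_derivative g (at y) b\<bar> \<le> K * norm (x - y)"
begin

text \<open>
Differentiation under the integral sign. As the first-order Taylor remainder of the kernel is quadratic
uniformly in its base point, it can be integrated against \<open>f\<close>: the remainder of the convolution is
again quadratic, with the constant multiplied by the \<open>L\<^sup>1\<close> norm of \<open>f\<close>.
\<close>

lemma convolution_has_derivative:
  assumes f: "integrable lebesgue f"
  shows "(convolution f g has_derivative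
    (\<lambda>h. LINT \<xi>|lebesgue. f \<xi> * frechet_derivative g (at (x - \<xi>)) h)) (at x)"
proof -
  let ?D = "\<lambda>x. frechet_derivative g (at x)"
  let ?C = "real DIM('a) * K"
  let ?n = "LINT \<xi>|lebesgue. \<bar>f \<xi>\<bar>"
  let ?I = "\<lambda>h. LINT \<xi>|lebesgue. f \<xi> * ?D (x - \<xi>) h"
  have cg: "continuous_on UNIV g"
    using differentiable by (auto intro!: differentiable_imp_continuous_on differentiable_at_imp_differentiable_on)
  have int_g: "integrable lebesgue (\<lambda>\<xi>. f \<xi> * g (y - \<xi>))" for y
    using f cg bounded by (rule integrable_mult_translated_kernel)
  have D_le: "\<bar>?D z h\<bar> \<le> real DIM('a) * (norm h * M)" for z h
  proof -
    have M0: "M \<ge> 0"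
      using bounded[of 0] by linarith
    have "\<bar>?D z h\<bar> \<le> (\<Sum>b\<in>Basis. \<bar>(h \<bullet> b) *\<^sub>R ?D z b\<bar>)"
      unfolding frechet_derivative_eq_sum_Basis[OF differentiable, of z h] by (rule sum_abs)
    also have "\<dots> \<le> (\<Sum>b\<in>(Basis::'a set). norm h * M)"
      using partial_le M0 by (intro sum_mono) (auto simp: abs_mult intro!: mult_mono Basis_le_norm)
    finally show ?thesis by simp
  qed
  have int_D: "integrable lebesgue (\<lambda>\<xi>. f \<xi> * ?D (y - \<xi>) h)" for y h
    using f derivative_continuous D_le[of _ h] by (rule integrable_mult_translated_kernel)
  show ?thesis
  proof (rule has_derivativeI_sandwich[where e = 1 and H = "\<lambda>y. ?C * ?n * norm (y - x)"])
    have lin: "linear (?D z)" for z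
      using differentiable by (rule linear_frechet_derivative)
    have "linear ?I"
      using int_D by (intro linearI) (simp_all add: linear_add[OF lin] linear_scale[OF lin]
          distrib_left mult.left_commute)
    then show "bounded_linear ?I"
      by (simp add: linear_conv_bounded_linear)
    fix y assume "y \<noteq> x"
    have eq: "convolution f g y - convolution f g x - ?I (y - x) =
        (LINT \<xi>|lebesgue. f \<xi> * (g (y - \<xi>) - g (x - \<xi>) - ?D (x - \<xi>) (y - x)))"
      using int_g int_D by (simp add: convolution_def right_diff_distrib)
    have int: "integrable lebesgue (\<lambda>\<xi>. f \<xi> * (g (y - \<xi>) - g (x - \<xi>) - ?D (x - \<xi>) (y - x)))"
      using int_g int_D by (simp add: right_diff_distrib)
    have "\<bar>g (y - \<xi>) - g (x - \<xi>) - ?D (x - \<xi>) (y - x)\<bar> \<le> ?C * (norm (y - x) * norm (y - x))" for \<xi>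
      using first_order_remainder_le[OF differentiable K_nonneg partial_lipschitz, of "y - \<xi>" "x - \<xi>"] by simp
    then have "norm (convolution f g y - convolution f g x - ?I (y - x))
        \<le> ?C * (norm (y - x) * norm (y - x)) * ?n"
      unfolding eq real_norm_def by (intro abs_integral_le_mult_L1 f int)
    then show "norm (convolution f g y - convolution f g x - ?I (y - x)) / norm (y - x)
        \<le> ?C * ?n * norm (y - x)"
      using \<open>y \<noteq> x\<close> by (simp add: divide_simps mult_ac)
  next
    show "((\<lambda>y. ?C * ?n * norm (y - x)) \<longlongrightarrow> 0) (at x)"
      by (auto intro!: tendsto_eq_intros)
  qed simp
qed


lemma frechet_derivative_convolution:
  assumes "integrable lebesgue f"
  shows "frechet_derivative (convolution f g) (at x) h =
    (LINT \<xi>|lebesgue. f \<xi> * frechet_derivative g (at (x - \<xi>)) h)"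
  by (rule fun_cong[OF frechet_derivative_at[OF convolution_has_derivative[OF assms], symmetric]])

lemma convolution_differentiable:
  assumes "integrable lebesgue f"
  shows "convolution f g differentiable (at x)"
  using convolution_has_derivative[OF assms] by (rule differentiableI)

lemma convolution_partial_le:
  assumes f: "integrable lebesgue f" and b: "b \<in> Basis"
  shows "\<bar>frechet_derivative (convolution f g) (at x) b\<bar> \<le> M * (LINT \<xi>|lebesgue. \<bar>f \<xi>\<bar>)"
  unfolding frechet_derivative_convolution[OF f]
  using f derivative_continuous partial_le[OF b]
  by (intro abs_integral_le_mult_L1 integrable_mult_translated_kernel[where M = M]) auto

lemma convolution_partial_lipschitz:
  assumes f: "integrable lebesgue f" and b: "b \<in> Basis"
  shows "\<bar>frechet_derivative (convolution f g) (at x) b - frechet_derivative (convolution f g) (at y) b\<bar>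
    \<le> K * norm (x - y) * (LINT \<xi>|lebesgue. \<bar>f \<xi>\<bar>)"
proof -
  let ?D = "\<lambda>x. frechet_derivative g (at x) b"
  have int: "integrable lebesgue (\<lambda>\<xi>. f \<xi> * ?D (z - \<xi>))" for z
    using f derivative_continuous partial_le[OF b] by (rule integrable_mult_translated_kernel)
  have int2: "integrable lebesgue (\<lambda>\<xi>. f \<xi> * (?D (x - \<xi>) - ?D (y - \<xi>)))"
    using int by (simp add: right_diff_distrib)
  have "\<bar>?D (x - \<xi>) - ?D (y - \<xi>)\<bar> \<le> K * norm (x - y)" for \<xi>
    using partial_lipschitz[OF b, of "x - \<xi>" "y - \<xi>"] by simp
  then have "\<bar>LINT \<xi>|lebesgue. f \<xi> * (?D (x - \<xi>) - ?D (y - \<xi>))\<bar>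
      \<le> K * norm (x - y) * (LINT \<xi>|lebesgue. \<bar>f \<xi>\<bar>)"
    by (intro abs_integral_le_mult_L1 f int2)
  then show ?thesis
    using int by (simp add: frechet_derivative_convolution[OF f] right_diff_distrib)
qed

end

lemma C11_kernel_if_vanishing:
  fixes g :: "'a::euclidean_space \<Rightarrow> real"
  assumes g: "Ck (Suc (Suc k)) g" and zero: "\<And>x. norm x > R \<Longrightarrow> g x = 0"
  shows "\<exists>M K. C11_kernel g M K"
proof -
  let ?D = "\<lambda>b x. frechet_derivative g (at x) b"
  have D: "Ck (Suc k) (?D b)" for b
    using g by (rule Ck_Suc_derivative)
  have D0: "?D b x = 0" if "norm x > R" for b x
    using zero that by (rule frechet_derivative_vanishing)
  obtain M0 where M0: "M0 \<ge> 0" "\<And>x. norm (g x) \<le> M0"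
    using continuous_vanishing_bounded[OF Ck_continuous[OF g] zero] by auto
  have "\<forall>b. \<exists>B\<ge>0. \<forall>x. norm (?D b x) \<le> B"
    using continuous_vanishing_bounded[OF Ck_continuous[OF D] D0] by blast
  then obtain B where B: "\<And>b. B b \<ge> 0" "\<And>b x. \<bar>?D b x\<bar> \<le> B b"
    unfolding real_norm_def by metis
  have "\<forall>b. \<exists>L\<ge>0. \<forall>x y. norm (?D b x - ?D b y) \<le> L * norm (x - y)"
    using Ck_vanishing_lipschitz[OF D D0] by blast
  then obtain L where L: "\<And>b. L b \<ge> 0" "\<And>b x y. \<bar>?D b x - ?D b y\<bar> \<le> L b * norm (x - y)"
    unfolding real_norm_def by metis
  define M where "M = M0 + (\<Sum>b\<in>Basis. B b)"
  define K where "K = (\<Sum>b\<in>(Basis::'a set). L b)"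
  have "C11_kernel g M K"
  proof
    show "g differentiable (at x)" for x
      using g by (rule Ck_Suc_differentiable)
    have "M0 \<le> M"
      using B(1) by (simp add: M_def sum_nonneg)
    then show "\<bar>g x\<bar> \<le> M" for x
      using M0(2)[of x] by simp
    show "continuous_on UNIV (\<lambda>x. ?D h x)" for h
      by (rule Ck_continuous[OF D])
    show "K \<ge> 0"
      using L(1) by (simp add: K_def sum_nonneg)
    fix b x y :: 'a assume b: "b \<in> Basis"
    have "B b \<le> M"
      using member_le_sum[OF b, of B] B(1) M0(1) by (simp add: M_def)
    then show "\<bar>?D b x\<bar> \<le> M"
      using B(2)[of x b] by linarith
    have "L b \<le> K"
      using member_le_sum[OF b, of L] L(1) by (simp add: K_def)
    then show "\<bar>?D b x - ?D b y\<bar> \<le> K * norm (x - y)"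
      using L(2)[of x b y] mult_right_mono[of "L b" K "norm (x - y)"] by simp
  qed
  then show ?thesis by blast
qed

section \<open>Radially decreasing kernels\<close>

lemma radial_profile_eq:
  fixes g :: "'a::real_normed_vector \<Rightarrow> real"
  assumes "\<And>x. g x = gt (norm x)" "\<And>s. gt (- s) = gt s" "norm e = 1"
  shows "gt s = g (s *\<^sub>R e)"
  using assms by (cases "s \<ge> 0") auto

text \<open>
On a ray from the origin, a radial function is its profile, which is how the profile inherits differentiability;
in particular the sign of \<open>deriv gt\<close> is the sign of a genuine derivative.
\<close>

lemma radial_antimono:
  fixes g :: "'a::euclidean_space \<Rightarrow> real"
  assumes g: "\<And>x. g differentiable (at x)"
    and radial: "\<And>x. g x = gt (norm x)" and even: "\<And>s. gt (- s) = gt s"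
    and deriv: "\<And>s. s \<ge> 0 \<Longrightarrow> deriv gt s \<le> 0"
    and "norm x \<le> norm y"
  shows "g y \<le> g x"
proof -
  obtain e :: 'a where e: "norm e = 1"
    using vector_choose_size[of 1] by auto
  have gt: "gt = (\<lambda>s. g (s *\<^sub>R e))"
    using radial_profile_eq[of g gt, OF radial even e] by auto
  have "gt differentiable (at s)" for s
  proof -
    have "(g has_derivative frechet_derivative g (at (s *\<^sub>R e))) (at (s *\<^sub>R e))"
      using g by (simp add: frechet_derivative_works)
    then have "((\<lambda>s. g (s *\<^sub>R e)) has_derivative
        (\<lambda>h. frechet_derivative g (at (s *\<^sub>R e)) (h *\<^sub>R e))) (at s)"
      by (rule has_derivative_compose[rotated]) (auto intro!: derivative_eq_intros)
    then show ?thesis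
      unfolding gt by (rule differentiableI)
  qed
  then have der: "DERIV gt s :> deriv gt s" for s
    by (simp add: DERIV_deriv_iff_real_differentiable)
  have "gt (norm x) \<ge> gt (norm y)"
  proof (rule DERIV_nonpos_imp_nonincreasing[OF \<open>norm x \<le> norm y\<close>])
    fix s assume "norm x \<le> s"
    then have "s \<ge> 0"
      using norm_ge_zero order_trans by blast
    then show "\<exists>d. DERIV gt s :> d \<and> d \<le> 0"
      using der deriv by blast
  qed
  then show ?thesis
    by (simp add: radial)
qed

lemma continuous_eq_0_outside_spt:
  fixes f :: "'a::euclidean_space \<Rightarrow> real"
  assumes f: "continuous_on UNIV f" and x: "x \<notin> spt f"
  shows "f x = 0"
proof (rule ccontr)
  assume "f x \<noteq> 0"
  let ?S = "- spt f \<inter> {x. f x \<noteq> 0}"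
  have "open ?S"
    using f closed_spt[of f] by (intro open_Int open_Compl open_Collect_neq continuous_on_const) auto
  moreover have "AE x in lebesgue. x \<notin> ?S"
    using iffD1[OF spt_subset_iff[OF closed_spt] subset_refl, of f] by eventually_elim auto
  then have "negligible ?S"
    unfolding negligible_iff_null_sets eventually_ae_filter by (auto intro: completion.complete2)
  ultimately show False
    using open_not_negligible x \<open>f x \<noteq> 0\<close> by blast
qed

text \<open>
Moving from \<open>z\<close> in a direction \<open>a\<close> with \<open>a \<bullet> z \<ge> 0\<close> does not
decrease the norm. Arguing along this half-line avoids the gradient formula for radial functions, which is
singular at the origin.
\<close>

lemma directional_derivative_nonpos:
  fixes g :: "'a::real_inner \<Rightarrow> real"
  assumes g: "g differentiable (at z)"
    and antimono: "\<And>x y. norm x \<le> norm y \<Longrightarrow> g y \<le> g x"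
    and az: "a \<bullet> z \<ge> 0"
  shows "frechet_derivative g (at z) a \<le> 0"
proof (rule ccontr)
  assume pos: "\<not> ?thesis"
  have "(g has_derivative frechet_derivative g (at z)) (at (z + 0 *\<^sub>R a))"
    using g by (simp add: frechet_derivative_works)
  then have "((\<lambda>s. g (z + s *\<^sub>R a)) has_derivative
      (\<lambda>h. frechet_derivative g (at z) (h *\<^sub>R a))) (at 0)"
    by (rule has_derivative_compose[rotated]) (auto intro!: derivative_eq_intros)
  then have "((\<lambda>s. g (z + s *\<^sub>R a)) has_real_derivative frechet_derivative g (at z) a) (at 0)"
    using linear_scale[OF linear_frechet_derivative[OF g]]
    by (simp add: has_field_derivative_def mult_commute_abs)
  then obtain d where d: "d > 0" "\<forall>h>0. h < d \<longrightarrow> g (z + 0 *\<^sub>R a) < g (z + (0 + h) *\<^sub>R a)"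
    using DERIV_pos_inc_right pos by (metis not_le)
  then have "g z < g (z + (d / 2) *\<^sub>R a)"
    by auto
  moreover have "norm z \<le> norm (z + (d / 2) *\<^sub>R a)"
    using az d(1) by (simp add: norm_le inner_add_left inner_add_right inner_commute[of z a])
  ultimately show False
    using antimono by (meson not_le)
qed

text \<open>
The attraction towards the mass: if \<open>f\<close> is a nonnegative density carried by the half-space below
\<open>x\<close> in direction \<open>a\<close>, then moving along \<open>a\<close> moves away from every point
of the mass, so the average of a radially decreasing kernel cannot increase.
\<close>

lemma (in C11_kernel) convolution_derivative_nonpos:
  assumes f: "integrable lebesgue f" "AE \<xi> in lebesgue. f \<xi> \<ge> 0"
      "AE \<xi> in lebesgue. a \<bullet> \<xi> > a \<bullet> x \<longrightarrow> f \<xi> = 0"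
    and antimono: "\<And>x y. norm x \<le> norm y \<Longrightarrow> g y \<le> g x"
  shows "frechet_derivative (convolution f g) (at x) a \<le> 0"
proof -
  have "AE \<xi> in lebesgue. f \<xi> * frechet_derivative g (at (x - \<xi>)) a \<le> 0"
    using f(2,3)
  proof eventually_elim
    case (elim \<xi>)
    show ?case
    proof (cases "a \<bullet> \<xi> > a \<bullet> x")
      case False
      then have "frechet_derivative g (at (x - \<xi>)) a \<le> 0"
        using differentiable antimono by (intro directional_derivative_nonpos) (auto simp: inner_diff_right)
      then show ?thesis
        using elim by (simp add: mult_nonneg_nonpos)
    qed (use elim in simp)
  qed
  then have "0 \<le> (LINT \<xi>|lebesgue. - (f \<xi> * frechet_derivative g (at (x - \<xi>)) a))"
    by (intro integral_nonneg_AE) simp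
  then show ?thesis
    by (simp add: frechet_derivative_convolution[OF f(1)])
qed

section \<open>Bounds on the nonlocal gradient\<close>

lemma norm_vec_le_sum: "norm x \<le> (\<Sum>i\<in>UNIV. norm (x $ i))"
  unfolding norm_vec_def by (rule L2_set_le_sum) simp

lemma norm_matrix_le:
  fixes W :: "real^'m^'n"
  assumes "\<And>j i. \<bar>W $ j $ i\<bar> \<le> c"
  shows "norm W \<le> real CARD('n) * (real CARD('m) * c)"
proof -
  have "norm (W $ j) \<le> real CARD('m) * c" for j
    using order_trans[OF norm_vec_le_sum sum_bounded_above[of UNIV "\<lambda>i. norm (W $ j $ i)" c]] assms
    by simp
  then show ?thesis
    using order_trans[OF norm_vec_le_sum sum_bounded_above[of UNIV "\<lambda>j. norm (W $ j)"]] by simp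
qed

lemma norm_column_le_norm:
  fixes W :: "real^'m^'n"
  shows "norm (column i W) \<le> norm W"
  unfolding norm_vec_def[of W] norm_vec_def[of "column i W"]
  by (rule L2_set_mono) (auto simp: column_def component_le_norm_cart)

lemma integral_abs_component_le:
  fixes r :: "'a::euclidean_space \<Rightarrow> real^'m"
  assumes r: "integrable lebesgue r"
  shows "integrable lebesgue (\<lambda>x. r x $ i)"
    and "(LINT x|lebesgue. \<bar>r x $ i\<bar>) \<le> (LINT x|lebesgue. norm (r x))"
proof -
  show int: "integrable lebesgue (\<lambda>x. r x $ i)"
    by (rule integrable_bounded_linear[OF bounded_linear_vec_nth r])
  show "(LINT x|lebesgue. \<bar>r x $ i\<bar>) \<le> (LINT x|lebesgue. norm (r x))"
    using r int by (intro integral_mono) (auto simp: component_le_norm_cart)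
qed

lemma grad_conv_le:
  fixes r :: "real^'n \<Rightarrow> real^'m"
  assumes kernel: "C11_kernel g M K" and r: "integrable lebesgue r"
    and R: "(LINT x|lebesgue. norm (r x)) \<le> R"
  shows "norm (grad_conv r g x) \<le> real CARD('n) * (real CARD('m) * (M * R))"
proof (rule norm_matrix_le)
  interpret C11_kernel g M K by (rule kernel)
  fix j :: 'n and k :: 'm
  have "\<bar>grad_conv r g x $ j $ k\<bar> \<le> M * (LINT \<xi>|lebesgue. \<bar>r \<xi> $ k\<bar>)"
    unfolding grad_conv_def
    using convolution_partial_le[OF integral_abs_component_le(1)[OF r], of "axis j 1"]
    by (simp add: axis_in_Basis_iff)
  also have "\<dots> \<le> M * R"
    using order_trans[OF integral_abs_component_le(2)[OF r] R] bounded[of 0]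
    by (intro mult_left_mono) auto
  finally show "\<bar>grad_conv r g x $ j $ k\<bar> \<le> M * R" .
qed

lemma grad_conv_lipschitz:
  fixes r :: "real^'n \<Rightarrow> real^'m"
  assumes kernel: "C11_kernel g M K" and r: "integrable lebesgue r"
    and R: "(LINT x|lebesgue. norm (r x)) \<le> R"
  shows "norm (grad_conv r g x - grad_conv r g y)
    \<le> real CARD('n) * (real CARD('m) * (K * R)) * norm (x - y)"
proof -
  interpret C11_kernel g M K by (rule kernel)
  have "norm (grad_conv r g x - grad_conv r g y)
      \<le> real CARD('n) * (real CARD('m) * (K * norm (x - y) * R))"
  proof (rule norm_matrix_le)
    fix j :: 'n and k :: 'm
    have "\<bar>(grad_conv r g x - grad_conv r g y) $ j $ k\<bar>
        \<le> K * norm (x - y) * (LINT \<xi>|lebesgue. \<bar>r \<xi> $ k\<bar>)"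
      unfolding grad_conv_def
      using convolution_partial_lipschitz[OF integral_abs_component_le(1)[OF r], of "axis j 1"]
      by (simp add: axis_in_Basis_iff)
    also have "\<dots> \<le> K * norm (x - y) * R"
      using order_trans[OF integral_abs_component_le(2)[OF r] R] K_nonneg
      by (intro mult_left_mono) auto
    finally show "\<bar>(grad_conv r g x - grad_conv r g y) $ j $ k\<bar> \<le> K * norm (x - y) * R" .
  qed
  then show ?thesis
    by (simp add: mult_ac)
qed

text \<open>
The matrix of partial derivatives is only meaningful once the convolution is known to be differentiable; then
its columns are genuine gradients.
\<close>

lemma inner_column_grad_conv:
  fixes a :: "real^'n" and r :: "real^'n \<Rightarrow> real^'m"
  assumes "convolution (\<lambda>\<xi>. r \<xi> $ i) g differentiable (at x)"
  shows "a \<bullet> column i (grad_conv r g x) = frechet_derivative (convolution (\<lambda>\<xi>. r \<xi> $ i) g) (at x) a"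
proof -
  let ?D = "frechet_derivative (convolution (\<lambda>\<xi>. r \<xi> $ i) g) (at x)"
  have lin: "linear ?D"
    using assms by (rule linear_frechet_derivative)
  have "?D a = ?D (\<Sum>j\<in>UNIV. (a $ j) *\<^sub>R axis j 1)"
    using basis_expansion[of a] by (simp add: scalar_mult_eq_scaleR)
  also have "\<dots> = (\<Sum>j\<in>UNIV. a $ j * ?D (axis j 1))"
    by (simp add: linear_sum[OF lin] linear_scale[OF lin])
  finally show ?thesis
    by (simp add: inner_vec_def column_def grad_conv_def)
qed

lemma C0_L1_bounded_on_compact:
  assumes "C0_L1 UNIV \<rho>" and "compact S"
  shows "\<exists>R. \<forall>t\<in>S. (LINT x|lebesgue. norm (\<rho> t x)) \<le> R"
proof -
  let ?n = "\<lambda>t. LINT x|lebesgue. norm (\<rho> t x)"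
  have int: "integrable lebesgue (\<rho> t)" for t
    using assms(1) by (auto simp: C0_L1_def L1_def)
  have "(?n \<longlongrightarrow> ?n t) (at t)" for t
  proof (rule LIM_zero_cancel, rule Lim_null_comparison)
    show "((\<lambda>s. LINT x|lebesgue. norm (\<rho> s x - \<rho> t x)) \<longlongrightarrow> 0) (at t)"
      using assms(1) by (auto simp: C0_L1_def)
    have "norm (?n s - ?n t) \<le> (LINT x|lebesgue. norm (\<rho> s x - \<rho> t x))" for s
    proof -
      have "?n s - ?n t = (LINT x|lebesgue. norm (\<rho> s x) - norm (\<rho> t x))"
        using int by simp
      also have "\<bar>\<dots>\<bar> \<le> (LINT x|lebesgue. \<bar>norm (\<rho> s x) - norm (\<rho> t x)\<bar>)"
        by (rule integral_abs_bound)
      also have "\<dots> \<le> (LINT x|lebesgue. norm (\<rho> s x - \<rho> t x))"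
        using int by (intro integral_mono) (auto intro: norm_triangle_ineq3)
      finally show ?thesis by simp
    qed
    then show "\<forall>\<^sub>F s in at t. norm (?n s - ?n t) \<le> (LINT x|lebesgue. norm (\<rho> s x - \<rho> t x))"
      by simp
  qed
  then have "continuous_on S ?n"
    by (auto simp: continuous_on_def intro: tendsto_within_subset)
  then have "bounded (?n ` S)"
    using assms(2) compact_continuous_image compact_imp_bounded by blast
  then show ?thesis
    unfolding bounded_iff by (auto intro: order_trans[OF abs_ge_self])
qed

section \<open>Characteristics and half-spaces\<close>

text \<open>
Gronwall's inequality for the squared distance, which unlike the distance is differentiable even where the
trajectories meet. The second estimate, backward in time, gives uniqueness of the trajectory through a point at
a positive time.
\<close>

lemma trajectories_distance_le:
  fixes p q :: "real \<Rightarrow> 'a::real_inner" and u :: "real \<Rightarrow> 'a \<Rightarrow> 'a"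
  assumes p: "\<And>s. s \<in> {0..T} \<Longrightarrow> (p has_vector_derivative u s (p s)) (at s)"
    and q: "\<And>s. s \<in> {0..T} \<Longrightarrow> (q has_vector_derivative u s (q s)) (at s)"
    and lip: "\<And>s x y. s \<in> {0..T} \<Longrightarrow> norm (u s x - u s y) \<le> L * norm (x - y)"
    and t: "t \<in> {0..T}"
  shows "norm (p t - q t) \<le> exp (L * t) * norm (p 0 - q 0)"
    and "norm (p 0 - q 0) \<le> exp (L * t) * norm (p t - q t)"
proof -
  define d where "d s = p s - q s" for s
  define e where "e s = u s (p s) - u s (q s)" for s
  have der: "((\<lambda>s. d s \<bullet> d s) has_real_derivative 2 * (d s \<bullet> e s)) (at s)" if "s \<in> {0..T}" for s
  proof -
    have "(d has_derivative (\<lambda>h. h *\<^sub>R e s)) (at s)"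
      using has_vector_derivative_diff[OF p[OF that] q[OF that]]
      by (simp add: has_vector_derivative_def d_def[abs_def] e_def)
    then have "((\<lambda>s. d s \<bullet> d s) has_derivative (\<lambda>h. d s \<bullet> (h *\<^sub>R e s) + (h *\<^sub>R e s) \<bullet> d s)) (at s)"
      by (intro has_derivative_inner)
    then show ?thesis
      unfolding has_field_derivative_def
      by (rule has_derivative_eq_rhs) (simp add: fun_eq_iff inner_commute)
  qed
  have de: "\<bar>d s \<bullet> e s\<bar> \<le> L * (d s \<bullet> d s)" if "s \<in> {0..T}" for s
  proof -
    have "\<bar>d s \<bullet> e s\<bar> \<le> norm (d s) * norm (e s)"
      by (rule Cauchy_Schwarz_ineq2)
    also have "\<dots> \<le> norm (d s) * (L * norm (d s))"
      using lip[OF that] by (intro mult_left_mono) (auto simp: d_def e_def)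
    finally show ?thesis
      by (simp add: dot_square_norm power2_eq_square mult_ac)
  qed
  have exp2: "(exp (L * t))\<^sup>2 = exp (2 * L * t)"
    by (simp add: exp_double[symmetric] mult.assoc)
  have "d t \<bullet> d t * exp (- 2 * L * t) \<le> d 0 \<bullet> d 0 * exp (- 2 * L * 0)"
  proof (rule DERIV_nonpos_imp_nonincreasing[where f = "\<lambda>s. d s \<bullet> d s * exp (- 2 * L * s)"])
    fix s assume "0 \<le> s" "s \<le> t"
    then have s: "s \<in> {0..T}"
      using t by auto
    show "\<exists>y. ((\<lambda>s. d s \<bullet> d s * exp (- 2 * L * s)) has_real_derivative y) (at s) \<and> y \<le> 0"
    proof (intro exI conjI)
      show "((\<lambda>s. d s \<bullet> d s * exp (- 2 * L * s)) has_real_derivative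
          2 * (d s \<bullet> e s - L * (d s \<bullet> d s)) * exp (- 2 * L * s)) (at s)"
        by (rule derivative_eq_intros der[OF s] refl)+ (simp add: algebra_simps)
      show "2 * (d s \<bullet> e s - L * (d s \<bullet> d s)) * exp (- 2 * L * s) \<le> 0"
        using abs_le_D1[OF de[OF s]] by (simp add: mult_le_0_iff)
    qed
  qed (use t in auto)
  then have "d t \<bullet> d t \<le> exp (2 * L * t) * (d 0 \<bullet> d 0)"
    by (simp add: exp_minus field_simps)
  then have "(norm (d t))\<^sup>2 \<le> (exp (L * t) * norm (d 0))\<^sup>2"
    unfolding power_mult_distrib exp2 dot_square_norm .
  then show "norm (p t - q t) \<le> exp (L * t) * norm (p 0 - q 0)"
    unfolding d_def by (rule power2_le_imp_le) simp
  have "d 0 \<bullet> d 0 * exp (2 * L * 0) \<le> d t \<bullet> d t * exp (2 * L * t)"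
  proof (rule DERIV_nonneg_imp_nondecreasing[where f = "\<lambda>s. d s \<bullet> d s * exp (2 * L * s)"])
    fix s assume "0 \<le> s" "s \<le> t"
    then have s: "s \<in> {0..T}"
      using t by auto
    show "\<exists>y. ((\<lambda>s. d s \<bullet> d s * exp (2 * L * s)) has_real_derivative y) (at s) \<and> 0 \<le> y"
    proof (intro exI conjI)
      show "((\<lambda>s. d s \<bullet> d s * exp (2 * L * s)) has_real_derivative
          2 * (d s \<bullet> e s + L * (d s \<bullet> d s)) * exp (2 * L * s)) (at s)"
        by (rule derivative_eq_intros der[OF s] refl)+ (simp add: algebra_simps)
      show "0 \<le> 2 * (d s \<bullet> e s + L * (d s \<bullet> d s)) * exp (2 * L * s)"
        using abs_le_D2[OF de[OF s]] by (simp add: zero_le_mult_iff)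
    qed
  qed (use t in auto)
  then have "d 0 \<bullet> d 0 \<le> exp (2 * L * t) * (d t \<bullet> d t)"
    by (simp add: mult.commute)
  then have "(norm (d 0))\<^sup>2 \<le> (exp (L * t) * norm (d t))\<^sup>2"
    unfolding power_mult_distrib exp2 dot_square_norm .
  then show "norm (p 0 - q 0) \<le> exp (L * t) * norm (p t - q t)"
    unfolding d_def by (rule power2_le_imp_le) simp
qed

lemma inner_trajectory_has_derivative:
  assumes "(p has_vector_derivative w) (at s)"
  shows "((\<lambda>s. a \<bullet> p s) has_real_derivative a \<bullet> w) (at s)"
  using has_derivative_inner_right[OF assms[unfolded has_vector_derivative_def], of a]
  unfolding has_field_derivative_def
  by (rule has_derivative_eq_rhs) (simp add: fun_eq_iff)

text \<open>
The velocity is known to point back only at levels that no trajectory exceeds at the given time, not on the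
boundary of the half-space itself, so the usual comparison at the boundary is circular. Instead, let
\<open>N\<close> be the supremum of \<open>a \<bullet> X s y\<close> over all \<open>s\<close> in the time
interval and all \<open>y\<close> in the half-space; it is finite because the speed is bounded. The normal
velocity is nonpositive at level \<open>N\<close>, hence by the Lipschitz condition at most
\<open>L * (N - a \<bullet> x)\<close> at a point \<open>x\<close> below it. The gap to \<open>N\<close> then decays at most
exponentially, so it stays above \<open>(N - b) * exp (- (L * T))\<close> uniformly. As \<open>N\<close> is a
supremum of the levels reached, this uniform gap must be zero or negative, that is \<open>N \<le> b\<close>.
\<close>

lemma halfspace_invariant:
  fixes u :: "real \<Rightarrow> 'a::euclidean_space \<Rightarrow> 'a" and X :: "real \<Rightarrow> 'a \<Rightarrow> 'a"
  assumes X0: "\<And>y. X 0 y = y"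
    and X: "\<And>s y. s \<in> {0..T} \<Longrightarrow> ((\<lambda>s. X s y) has_vector_derivative u s (X s y)) (at s)"
    and L: "L \<ge> 0" "\<And>s x y. s \<in> {0..T} \<Longrightarrow> norm (u s x - u s y) \<le> L * norm (x - y)"
    and B: "\<And>s x. s \<in> {0..T} \<Longrightarrow> norm (u s x) \<le> B"
    and inward: "\<And>s x N. s \<in> {0..T} \<Longrightarrow> (\<And>y. a \<bullet> y \<le> b \<Longrightarrow> a \<bullet> X s y \<le> N) \<Longrightarrow>
      a \<bullet> x = N \<Longrightarrow> a \<bullet> u s x \<le> 0"
    and t: "t \<in> {0..T}" and y: "a \<bullet> y \<le> b"
  shows "a \<bullet> X t y \<le> b"
proof (cases "a = 0")
  case True
  then show ?thesis using y by simp
next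
  case False
  define A where "A = {0..T} \<times> {y. a \<bullet> y \<le> b}"
  define N where "N = (SUP (s, y) \<in> A. a \<bullet> X s y)"
  have bdd: "bdd_above ((\<lambda>(s, y). a \<bullet> X s y) ` A)"
  proof (rule bdd_aboveI2[where M = "b + norm a * B * T"], clarsimp simp: A_def)
    fix s y assume s: "0 \<le> s" "s \<le> T" and y: "a \<bullet> y \<le> b"
    have "a \<bullet> X s y - norm a * B * s \<le> a \<bullet> X 0 y - norm a * B * 0"
    proof (rule DERIV_nonpos_imp_nonincreasing[OF s(1), where f = "\<lambda>s. a \<bullet> X s y - norm a * B * s"])
      fix r assume "0 \<le> r" "r \<le> s"
      then have r: "r \<in> {0..T}" using s by auto
      have "((\<lambda>s. a \<bullet> X s y - norm a * B * s) has_real_derivative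
          a \<bullet> u r (X r y) - norm a * B) (at r)"
        by (rule derivative_eq_intros inner_trajectory_has_derivative[OF X[OF r]] refl)+ simp
      moreover have "a \<bullet> u r (X r y) \<le> norm a * B"
        using norm_cauchy_schwarz[of a "u r (X r y)"] B[OF r, of "X r y"]
        by (meson mult_left_mono norm_ge_zero order_trans)
      ultimately show "\<exists>z. ((\<lambda>s. a \<bullet> X s y - norm a * B * s) has_real_derivative z) (at r) \<and> z \<le> 0"
        by (intro exI conjI) auto
    qed
    moreover have "norm a * B * s \<le> norm a * B * T"
      using s order_trans[OF norm_ge_zero B[of s 0]]
      by (intro mult_left_mono mult_nonneg_nonneg) auto
    ultimately show "a \<bullet> X s y \<le> b + norm a * B * T"
      using y by (simp add: X0)
  qed
  have N: "a \<bullet> X s y \<le> N" if "s \<in> {0..T}" "a \<bullet> y \<le> b" for s y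
    using cSUP_upper[OF _ bdd, of "(s, y)"] that by (simp add: N_def A_def)
  have aa: "a \<bullet> a > 0"
    using False by simp
  have T0: "0 \<in> {0..T}" using t by auto
  \<comment> \<open>The level \<open>b\<close> is attained at time zero, at the point of the bounding hyperplane nearest to the origin.\<close>
  have bN: "b \<le> N"
    using N[OF T0, of "(b / (a \<bullet> a)) *\<^sub>R a"] aa by (simp add: X0)
  \<comment> \<open>Compare with the point of level \<open>N\<close> that is nearest to \<open>x\<close>, at distance \<open>(N - a \<bullet> x) / norm a\<close>.\<close>
  have speed: "a \<bullet> u s x \<le> L * (N - a \<bullet> x)" if s: "s \<in> {0..T}" and x: "a \<bullet> x \<le> N" for s x
  proof -
    define x' where "x' = x + ((N - a \<bullet> x) / (a \<bullet> a)) *\<^sub>R a"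
    have "a \<bullet> x' = N"
      using aa by (simp add: x'_def inner_add_right)
    then have "a \<bullet> u s x' \<le> 0"
      using inward[OF s N[OF s]] by blast
    moreover have "a \<bullet> (u s x - u s x') \<le> norm a * (L * norm (x - x'))"
      using norm_cauchy_schwarz[of a "u s x - u s x'"] L(2)[OF s, of x x']
      by (meson mult_left_mono norm_ge_zero order_trans)
    moreover have "norm a * (L * norm (x - x')) = L * (N - a \<bullet> x)"
      using x aa False by (simp add: x'_def dot_square_norm power2_eq_square)
    ultimately show ?thesis
      by (simp add: inner_diff_right)
  qed
  have le: "a \<bullet> X s y \<le> N - (N - b) * exp (- (L * T))" if s: "s \<in> {0..T}" and y: "a \<bullet> y \<le> b" for s y
  proof -
    have "(N - a \<bullet> X 0 y) * exp (L * 0) \<le> (N - a \<bullet> X s y) * exp (L * s)"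
    proof (rule DERIV_nonneg_imp_nondecreasing[where f = "\<lambda>s. (N - a \<bullet> X s y) * exp (L * s)"])
      fix r assume "0 \<le> r" "r \<le> s"
      then have r: "r \<in> {0..T}" using s by auto
      have "((\<lambda>s. (N - a \<bullet> X s y) * exp (L * s)) has_real_derivative
          (L * (N - a \<bullet> X r y) - a \<bullet> u r (X r y)) * exp (L * r)) (at r)"
        by (rule derivative_eq_intros inner_trajectory_has_derivative[OF X[OF r]] refl)+
          (simp add: algebra_simps)
      then show "\<exists>z. ((\<lambda>s. (N - a \<bullet> X s y) * exp (L * s)) has_real_derivative z) (at r) \<and> 0 \<le> z"
        using speed[OF r N[OF r y]] by (intro exI conjI) auto
    qed (use s in auto)
    then have "N - b \<le> (N - a \<bullet> X s y) * exp (L * s)"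
      using y by (simp add: X0)
    also have "\<dots> \<le> (N - a \<bullet> X s y) * exp (L * T)"
      using s L(1) N[OF s y] by (intro mult_left_mono) (auto intro: mult_left_mono)
    finally show ?thesis
      by (simp add: exp_minus field_simps)
  qed
  have "N \<le> N - (N - b) * exp (- (L * T))"
  proof -
    have "A \<noteq> {}" using t y by (auto simp: A_def)
    then have "(SUP (s, y) \<in> A. a \<bullet> X s y) \<le> N - (N - b) * exp (- (L * T))"
      using le by (intro cSUP_least) (auto simp: A_def)
    then show ?thesis
      by (simp only: N_def[symmetric])
  qed
  then have "N \<le> b"
    by (simp add: mult_le_0_iff not_le[symmetric])
  then show ?thesis
    using N[OF t y] by linarith
qed

text \<open>
Properties that hold almost everywhere are carried along by the flow: the points whose foot \<open>X 0 t
x\<close> is exceptional form the image of a null set under the forward flow map, which is Lipschitz. Uniqueness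
of trajectories is what makes the forward map the inverse of the backward one.
\<close>

lemma AE_flow_transport:
  fixes u :: "real \<Rightarrow> real^'n \<Rightarrow> real^'n"
  assumes X: "is_flow UNIV u X"
    and lip: "\<And>s x y. s \<in> {0..T} \<Longrightarrow> norm (u s x - u s y) \<le> L * norm (x - y)"
    and t: "t \<in> {0..T}"
  shows "X t 0 (X 0 t x) = x"
    and "AE x in lebesgue. P x \<Longrightarrow> AE x in lebesgue. P (X 0 t x)"
proof -
  have der: "((\<lambda>s. X s r y) has_vector_derivative u s (X s r y)) (at s)"
    and init: "X r r y = y" for r s y
    using X by (auto simp: is_flow_def)
  have "norm (X t t x - X t 0 (X 0 t x)) \<le> exp (L * t) * norm (X 0 t x - X 0 0 (X 0 t x))" for x
    by (rule trajectories_distance_le[OF der der lip t])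
  then show inv: "X t 0 (X 0 t x) = x" for x
    by (simp add: init)
  assume "AE x in lebesgue. P x"
  then have neg: "negligible {y. \<not> P y}"
    by (simp add: AE_iff_null_sets negligible_iff_null_sets completion.AE_iff_null_sets)
  have "norm (X t 0 y - X t 0 z) \<le> exp (L * t) * norm (y - z)" for y z
    using trajectories_distance_le(1)[OF der der lip t, of 0 y 0 z] by (simp add: init)
  then have "negligible (X t 0 ` {y. \<not> P y})"
    using neg by (intro negligible_locally_Lipschitz_image) (auto intro!: exI[of _ UNIV])
  moreover have "{x. \<not> P (X 0 t x)} \<subseteq> X t 0 ` {y. \<not> P y}"
    using inv by (auto intro!: image_eqI[where x = "X 0 t _"])
  ultimately have "negligible {x. \<not> P (X 0 t x)}"
    by (rule negligible_subset)
  then show "AE x in lebesgue. P (X 0 t x)"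
    by (simp add: AE_iff_null_sets negligible_iff_null_sets completion.AE_iff_null_sets)
qed

section \<open>Confinement of the solution\<close>

text \<open>
The representation along characteristics shows that \<open>\<rho> t\<close> stays nonnegative and that its mass
at time \<open>t\<close> lies below the farthest level reached by the characteristics that start in the
half-space. At that level the velocity, a nonnegative multiple of the gradient of \<open>\<rho>\<^sub>i *
\<eta>\<close>, points inward. The other components of \<open>\<rho>\<close> enter only through this multiple,
so they cannot affect the sign.
\<close>

lemma solution_vanishes_outside_halfspace:
  fixes V :: "real^'m^'n \<Rightarrow> real^'m^'n" and \<rho> :: "real \<Rightarrow> real^'n \<Rightarrow> real^'m"
  assumes V: "Ck (Suc k) V" and V_form: "\<And>w. V w = v (norm w) *\<^sub>R w"
    and v_pos: "\<And>s. s > 0 \<Longrightarrow> v s > 0"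
    and kernel: "C11_kernel \<eta> M K"
    and antimono: "\<And>x y. norm x \<le> norm y \<Longrightarrow> \<eta> y \<le> \<eta> x"
    and nonneg: "AE x in lebesgue. \<rho>\<^sub>o x $ i \<ge> 0"
    and sol: "is_solution UNIV V \<eta> \<rho>\<^sub>o \<rho>"
    and datum: "AE x in lebesgue. a \<bullet> x > b \<longrightarrow> \<rho>\<^sub>o x $ i = 0"
    and T: "T \<ge> 0"
  shows "AE x in lebesgue. a \<bullet> x > b \<longrightarrow> \<rho> T x $ i = 0"
proof -
  interpret C11_kernel \<eta> M K by (rule kernel)
  define W where "W t x = grad_conv (\<rho> t) \<eta> x" for t x
  define u where "u t x = column i (V (W t x))" for t x
  have C0: "C0_L1 UNIV \<rho>" and lag: "lagrangian_solution UNIV u (\<lambda>x. \<rho>\<^sub>o x $ i) (\<lambda>t x. \<rho> t x $ i)"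
    using sol unfolding is_solution_def u_def[abs_def] W_def[abs_def] by auto
  obtain X where X: "is_flow UNIV u X"
    and rep: "\<And>t. AE x in lebesgue. \<rho> t x $ i =
      \<rho>\<^sub>o (X 0 t x) $ i * exp (- (LBINT \<tau>=0..t. divergence (u \<tau>) (X \<tau> t x)))"
    using lag unfolding lagrangian_solution_def by blast
  have int: "integrable lebesgue (\<rho> t)" for t
    using C0 by (auto simp: C0_L1_def L1_def)
  have int_i: "integrable lebesgue (\<lambda>\<xi>. \<rho> t \<xi> $ k)" for t k
    by (rule integral_abs_component_le(1)[OF int])
  obtain R where R: "\<And>t. t \<in> {0..T} \<Longrightarrow> (LINT x|lebesgue. norm (\<rho> t x)) \<le> R"
    using C0_L1_bounded_on_compact[OF C0 compact_Icc] by blast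
  define c where "c = real CARD('n) * (real CARD('m) * (M * R))"
  define k' where "k' = real CARD('n) * (real CARD('m) * (K * R))"
  have W_le: "norm (W t x) \<le> c"
    and W_lip: "norm (W t x - W t y) \<le> k' * norm (x - y)" if "t \<in> {0..T}" for t x y
    unfolding W_def c_def k'_def
    using grad_conv_le[OF kernel int R[OF that]] grad_conv_lipschitz[OF kernel int R[OF that]] by auto
  \<comment> \<open>The nonlocal gradient stays in one ball for all times in the interval, and only the
    Lipschitz constant of \<open>V\<close> on this ball matters.\<close>
  obtain LV where LV: "LV \<ge> 0"
    "\<And>w z. w \<in> cball 0 c \<Longrightarrow> z \<in> cball 0 c \<Longrightarrow> norm (V w - V z) \<le> LV * norm (w - z)"
    using Ck_lipschitz_on_compact_convex[OF V compact_cball convex_cball] by blast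
  have "0 \<le> (LINT x|lebesgue. norm (\<rho> 0 x))"
    by (rule Bochner_Integration.integral_nonneg) simp
  then have "R \<ge> 0"
    by (rule order_trans) (use R[of 0] T in simp)
  then have c0: "c \<ge> 0" and k0: "k' \<ge> 0"
    using bounded[of 0] K_nonneg by (auto simp: c_def k'_def)
  have u_lip: "norm (u t x - u t y) \<le> LV * k' * norm (x - y)" if t: "t \<in> {0..T}" for t x y
  proof -
    have "u t x - u t y = column i (V (W t x) - V (W t y))"
      by (simp add: u_def column_def vec_eq_iff)
    also have "norm \<dots> \<le> norm (V (W t x) - V (W t y))"
      by (rule norm_column_le_norm)
    also have "\<dots> \<le> LV * norm (W t x - W t y)"
      using W_le[OF t] by (intro LV(2)) auto
    also have "\<dots> \<le> LV * (k' * norm (x - y))"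
      using W_lip[OF t] LV(1) by (intro mult_left_mono)
    finally show ?thesis
      by (simp add: mult.assoc)
  qed
  have u_le: "norm (u t x) \<le> LV * c" if t: "t \<in> {0..T}" for t x
  proof -
    have "norm (u t x) \<le> norm (V (W t x) - V 0)"
      unfolding u_def using norm_column_le_norm[of i "V (W t x)"] V_form[of 0] by simp
    also have "\<dots> \<le> LV * norm (W t x)"
      using LV(2)[of "W t x" 0] W_le[OF t] c0 by simp
    also have "\<dots> \<le> LV * c"
      using W_le[OF t] LV(1) by (intro mult_left_mono)
    finally show ?thesis .
  qed
  have inverse: "X t 0 (X 0 t x) = x" if "t \<in> {0..T}" for t x
    by (rule AE_flow_transport(1)[OF X u_lip that])
  have transport: "AE x in lebesgue. P (X 0 t x)"
    if "t \<in> {0..T}" "AE x in lebesgue. P x" for t P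
    by (rule AE_flow_transport(2)[OF X u_lip that])
  have pos: "AE x in lebesgue. \<rho> t x $ i \<ge> 0" if t: "t \<in> {0..T}" for t
    using rep[of t] transport[OF t nonneg]
    by eventually_elim simp
  have vanish: "AE x in lebesgue. a \<bullet> x > N \<longrightarrow> \<rho> t x $ i = 0"
    if t: "t \<in> {0..T}" and N: "\<And>y. a \<bullet> y \<le> b \<Longrightarrow> a \<bullet> X t 0 y \<le> N" for t N
    using rep[of t] transport[OF t datum]
  proof eventually_elim
    case (elim x)
    show ?case
      using elim inverse[OF t, of x] N[of "X 0 t x"] by (cases "a \<bullet> X 0 t x \<le> b") auto
  qed
  have inward: "a \<bullet> u t x \<le> 0"
    if t: "t \<in> {0..T}" and N: "\<And>y. a \<bullet> y \<le> b \<Longrightarrow> a \<bullet> X t 0 y \<le> N" and x: "a \<bullet> x = N" for t x N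
  proof -
    have "a \<bullet> column i (W t x) \<le> 0"
      unfolding W_def inner_column_grad_conv[OF convolution_differentiable[OF int_i]]
    proof (rule convolution_derivative_nonpos[OF int_i pos[OF t] _ antimono])
      show "AE \<xi> in lebesgue. a \<bullet> \<xi> > a \<bullet> x \<longrightarrow> \<rho> t \<xi> $ i = 0"
        unfolding x using t N by (rule vanish)
    qed
    moreover have "u t x = v (norm (W t x)) *\<^sub>R column i (W t x)"
      unfolding u_def V_form[of "W t x"] by (simp add: column_def vec_eq_iff)
    moreover have "column i (W t x) = 0" if "W t x = 0"
      using that by (simp add: column_def vec_eq_iff)
    ultimately show ?thesis
      using v_pos[of "norm (W t x)"] by (cases "W t x = 0") (auto simp: mult_le_0_iff)
  qed
  have flow0: "X 0 0 y = y" and flow: "((\<lambda>s. X s 0 y) has_vector_derivative u s (X s 0 y)) (at s)" for s y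
    using X by (auto simp: is_flow_def)
  have confined: "a \<bullet> X t 0 y \<le> b" if "t \<in> {0..T}" "a \<bullet> y \<le> b" for t y
  proof (rule halfspace_invariant[where X = "\<lambda>s. X s 0" and u = u, OF flow0 flow _ u_lip u_le])
    show "LV * k' \<ge> 0"
      using LV(1) k0 by simp
  qed (use that inward in blast)+
  show ?thesis
    using T confined by (intro vanish) auto
qed

theorem proposition2p5:
  fixes V :: "real^'m^'n \<Rightarrow> real^'m^'n"
    and v :: "real \<Rightarrow> real"
    and \<eta> :: "real^'n \<Rightarrow> real"
    and \<eta>t :: "real \<Rightarrow> real"
    and l :: real
    and \<rho>\<^sub>o :: "real^'n \<Rightarrow> real^'m"
    and \<rho> :: "real \<Rightarrow> real^'n \<Rightarrow> real^'m"
  assumes V: "assumption_V V"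
    and eta: "assumption_eta \<eta>"
    and datum: "\<rho>\<^sub>o \<in> L1 \<inter> Linf \<inter> BV"
    and V_form: "\<forall>w. V w = v (norm w) *\<^sub>R w"
    and v_pos: "\<forall>s>0. v s > 0"
    and eta_radial: "\<forall>x. \<eta> x = \<eta>t (norm x)"
    and etat_even: "\<forall>s. \<eta>t (- s) = \<eta>t s"
    and etat_deriv: "\<forall>s\<ge>0. deriv \<eta>t s \<le> 0"
    and l_pos: "l > 0"
    and etat_spt: "spt \<eta>t = {- l..l}"
    and datum_nonneg: "\<forall>i. AE x in lebesgue. \<rho>\<^sub>o x $ i \<ge> 0"
    and sol: "is_solution UNIV V \<eta> \<rho>\<^sub>o \<rho>"
  shows "(\<forall>C i. closed C \<and> convex C \<and> spt (\<lambda>x. \<rho>\<^sub>o x $ i) \<subseteq> C \<longrightarrow>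
            (\<forall>t\<ge>0. spt (\<lambda>x. \<rho> t x $ i) \<subseteq> C))
       \<and> (bounded (spt \<rho>\<^sub>o) \<longrightarrow>
            (\<forall>t\<ge>0. \<forall>i. spt (\<lambda>x. \<rho> t x $ i) \<subseteq> closure (convex hull (spt (\<lambda>x. \<rho>\<^sub>o x $ i)))))"
proof -
  have V1: "Ck (Suc 1) V" and eta3: "Ck (Suc (Suc 1)) \<eta>"
    using V eta by (simp_all add: assumption_V_def assumption_eta_def numeral_2_eq_2 numeral_3_eq_3)
  obtain e :: "real^'n" where e: "norm e = 1"
    using vector_choose_size[of 1] by auto
  have "\<eta>t = (\<lambda>s. \<eta> (s *\<^sub>R e))"
    using radial_profile_eq[of \<eta> \<eta>t, OF _ _ e] eta_radial etat_even by auto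
  moreover have "continuous_on UNIV (\<lambda>s. \<eta> (s *\<^sub>R e))"
    by (rule continuous_on_compose2[OF Ck_continuous[OF eta3]]) (auto intro!: continuous_intros)
  ultimately have "continuous_on UNIV \<eta>t"
    by simp
  then have "\<eta>t s = 0" if "s > l" for s
    using that etat_spt by (intro continuous_eq_0_outside_spt) auto
  then obtain M K where kernel: "C11_kernel \<eta> M K"
    using C11_kernel_if_vanishing[OF eta3, of l] eta_radial by auto
  have antimono: "\<eta> y \<le> \<eta> x" if "norm x \<le> norm y" for x y
    using radial_antimono[OF Ck_Suc_differentiable[OF eta3] _ _ _ that] eta_radial etat_even etat_deriv
    by blast
  have main: "spt (\<lambda>x. \<rho> t x $ i) \<subseteq> C"
    if C: "closed C" "convex C" "spt (\<lambda>x. \<rho>\<^sub>o x $ i) \<subseteq> C" and t: "t \<ge> 0" for C i t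
  proof
    fix z assume z: "z \<in> spt (\<lambda>x. \<rho> t x $ i)"
    show "z \<in> C"
    proof (rule ccontr)
      assume "z \<notin> C"
      then obtain a b where ab: "a \<bullet> z < b" "\<And>x. x \<in> C \<Longrightarrow> b < a \<bullet> x"
        using separating_hyperplane_closed_point[OF C(2,1)] by blast
      \<comment> \<open>The separation puts \<open>C\<close> above the level \<open>b\<close>, so the outer normal is \<open>- a\<close>.\<close>
      define H where "H = {x. - a \<bullet> x \<le> - b}"
      have H: "closed H"
        unfolding H_def by (rule closed_halfspace_le)
      have H_iff: "x \<notin> H \<longleftrightarrow> - a \<bullet> x > - b" for x
        by (auto simp: H_def)
      have "C \<subseteq> H"
        using ab(2) by (auto simp: H_def less_imp_le)
      then have "AE x in lebesgue. - a \<bullet> x > - b \<longrightarrow> \<rho>\<^sub>o x $ i = 0"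
        using spt_subset_iff[OF H, of "\<lambda>x. \<rho>\<^sub>o x $ i"] C(3) unfolding H_iff by auto
      then have "AE x in lebesgue. - a \<bullet> x > - b \<longrightarrow> \<rho> t x $ i = 0"
        using V_form v_pos datum_nonneg t
        by (intro solution_vanishes_outside_halfspace[where v = v, OF V1 _ _ kernel antimono _ sol]) auto
      then have "spt (\<lambda>x. \<rho> t x $ i) \<subseteq> H"
        using spt_subset_iff[OF H, of "\<lambda>x. \<rho> t x $ i"] unfolding H_iff by simp
      then show False
        using z ab(1) by (auto simp: H_def)
    qed
  qed
  moreover have "spt (\<lambda>x. \<rho>\<^sub>o x $ i) \<subseteq> closure (convex hull (spt (\<lambda>x. \<rho>\<^sub>o x $ i)))" for i
    using hull_subset closure_subset by (rule order_trans)
  ultimately show ?thesis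
    by (auto simp: convex_closure)
qed

end
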